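(* Let $G$ be a connected, infinite, unbounded graph. The following are equivalent: (1) $G$ is $3$-edge bottlenecked. (2) The intersection of any two distinct cycles in $G$ is empty or connected. (3) $G$ does not contain $D_4$ as a minor.
   Context: A graph consists of a vertex set and an edge set, each edge being associated with two vertices (its endpoints); multiple edges are allowed. The standing assumption that graphs are connected, infinite and unbounded applies to the host graph $G$, not to its minors. A path is a sequence of edges joining a sequence of distinct vertices. An $X,Y$ path is a path with one endpoint in $X$ and the other in $Y$. A cycle is a pair of paths that share exactly their endpoints (so two parallel edges form a cycle). The intersection of two cycles is the subgraph of their common vertices and edges. $n$-edge bottlenecked: for any two disjoint connected vertex sets $X,Y\subset V(G)$ there is a set $S\subseteq E(G)$ of size at most $n$ such that every $X,Y$ path contains an element of $S$. $D_n$ is the dipole graph: two vertices joined by $n$ parallel edges. $G$ contains $H$ as a minor if there are pairwise disjoint connected subgraphs $B_v$ of $G$ ($v\in V(H)$) and paths $P_e$ ($e\in E(H)$), where for $e$ with endpoints $u,v$ the path $P_e$ joins $B_u$ to $B_v$ and is otherwise disjoint from all the $B_w$, and the interiors of the paths $P_e$ are pairwise disjoint (so that contracting each of these sets produces $H$). *)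

theory Defs
  imports Main "HOL-Library.Uprod"
begin

text \<open>
  Undirected multigraphs. Every edge has an unordered pair of endpoints; loops
  (\<open>ends G e = Upair v v\<close>) are not excluded, but no path and no cycle uses one.
\<close>

record ('v, 'e) mgraph =
  verts :: "'v set"
  edges :: "'e set"
  ends :: "'e \<Rightarrow> 'v uprod"

definition multigraph :: "('v, 'e) mgraph \<Rightarrow> bool" where
  "multigraph G \<longleftrightarrow> (\<forall>e\<in>edges G. set_uprod (ends G e) \<subseteq> verts G)"

definition subgraph :: "('v, 'e) mgraph \<Rightarrow> ('v, 'e) mgraph \<Rightarrow> bool" where
  "subgraph H G \<longleftrightarrow>
     multigraph H \<and> verts H \<subseteq> verts G \<and> edges H \<subseteq> edges G \<and> ends H = ends G"

definition induced :: "('v, 'e) mgraph \<Rightarrow> 'v set \<Rightarrow> ('v, 'e) mgraph" where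
  "induced G X =
     \<lparr>verts = X, edges = {e \<in> edges G. set_uprod (ends G e) \<subseteq> X}, ends = ends G\<rparr>"

text \<open>Used only for subgraphs of a common host graph, so that the \<open>ends\<close> of both agree.\<close>

definition graph_inter :: "('v, 'e) mgraph \<Rightarrow> ('v, 'e) mgraph \<Rightarrow> ('v, 'e) mgraph" where
  "graph_inter C D =
     \<lparr>verts = verts C \<inter> verts D, edges = edges C \<inter> edges D, ends = ends C\<rparr>"

text \<open>
  A path is given by its vertices \<open>vs\<close> and its edges \<open>es\<close>, listed from one end to the
  other. The one-vertex path without edges is included.
\<close>

definition is_path :: "('v, 'e) mgraph \<Rightarrow> 'v list \<Rightarrow> 'e list \<Rightarrow> bool" where
  "is_path G vs es \<longleftrightarrow>
     length vs = Suc (length es) \<and> distinct vs \<and> set vs \<subseteq> verts G \<and> set es \<subseteq> edges G \<and>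
     (\<forall>i<length es. ends G (es ! i) = Upair (vs ! i) (vs ! Suc i))"

definition path_between ::
  "('v, 'e) mgraph \<Rightarrow> 'v set \<Rightarrow> 'v set \<Rightarrow> 'v list \<Rightarrow> 'e list \<Rightarrow> bool" where
  "path_between G X Y vs es \<longleftrightarrow> is_path G vs es \<and> hd vs \<in> X \<and> last vs \<in> Y"

definition inner_verts :: "'v list \<Rightarrow> 'v set" where
  "inner_verts vs = set vs - {hd vs, last vs}"

text \<open>The empty graph does not count as connected.\<close>

definition connected_graph :: "('v, 'e) mgraph \<Rightarrow> bool" where
  "connected_graph G \<longleftrightarrow>
     verts G \<noteq> {} \<and> (\<forall>u\<in>verts G. \<forall>v\<in>verts G. \<exists>vs es. path_between G {u} {v} vs es)"

definition connected_vertex_set :: "('v, 'e) mgraph \<Rightarrow> 'v set \<Rightarrow> bool" where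
  "connected_vertex_set G X \<longleftrightarrow> X \<subseteq> verts G \<and> connected_graph (induced G X)"

text \<open>Meaningful only if some path joins \<open>u\<close> and \<open>v\<close>.\<close>

definition graph_dist :: "('v, 'e) mgraph \<Rightarrow> 'v \<Rightarrow> 'v \<Rightarrow> nat" where
  "graph_dist G u v = (LEAST n. \<exists>vs es. path_between G {u} {v} vs es \<and> length es = n)"

definition unbounded_graph :: "('v, 'e) mgraph \<Rightarrow> bool" where
  "unbounded_graph G \<longleftrightarrow> (\<forall>n. \<exists>u\<in>verts G. \<exists>v\<in>verts G. n < graph_dist G u v)"

definition edge_bottlenecked :: "nat \<Rightarrow> ('v, 'e) mgraph \<Rightarrow> bool" where
  "edge_bottlenecked n G \<longleftrightarrow>
     (\<forall>X Y. connected_vertex_set G X \<and> connected_vertex_set G Y \<and> X \<inter> Y = {} \<longrightarrow>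
        (\<exists>S. S \<subseteq> edges G \<and> finite S \<and> card S \<le> n \<and>
             (\<forall>vs es. path_between G X Y vs es \<longrightarrow> set es \<inter> S \<noteq> {})))"

text \<open>
  The union of two paths sharing exactly their two (distinct) endpoints. Sharing an
  edge is excluded explicitly, since both paths might consist of one and the same edge.
\<close>

definition is_cycle :: "('v, 'e) mgraph \<Rightarrow> ('v, 'e) mgraph \<Rightarrow> bool" where
  "is_cycle G C \<longleftrightarrow>
     (\<exists>a b vs es ws fs. a \<noteq> b \<and>
        path_between G {a} {b} vs es \<and> path_between G {a} {b} ws fs \<and>
        set vs \<inter> set ws = {a, b} \<and> set es \<inter> set fs = {} \<and>
        C = \<lparr>verts = set vs \<union> set ws, edges = set es \<union> set fs, ends = ends G\<rparr>)"

definition dipole :: "nat \<Rightarrow> (bool, nat) mgraph" where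
  "dipole n = \<lparr>verts = UNIV, edges = {..<n}, ends = (\<lambda>_. Upair False True)\<rparr>"

text \<open>
  \<open>B\<close> assigns the branch sets; the path assigned to the edge \<open>e\<close> has vertices \<open>P e\<close> and
  edges \<open>Q e\<close>. The interior of a path comprises its edges, so that the paths of parallel
  edges are distinct even if they have no inner vertex. The notion is intended for
  loopless \<open>H\<close>.
\<close>

definition has_minor :: "('v, 'e) mgraph \<Rightarrow> ('w, 'f) mgraph \<Rightarrow> bool" where
  "has_minor G H \<longleftrightarrow>
     (\<exists>(B :: 'w \<Rightarrow> ('v, 'e) mgraph) (P :: 'f \<Rightarrow> 'v list) (Q :: 'f \<Rightarrow> 'e list).
        (\<forall>w\<in>verts H. subgraph (B w) G \<and> connected_graph (B w)) \<and>
        (\<forall>w\<in>verts H. \<forall>x\<in>verts H. w \<noteq> x \<longrightarrow> verts (B w) \<inter> verts (B x) = {}) \<and>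
        (\<forall>e\<in>edges H.
           (\<exists>u v. ends H e = Upair u v \<and>
                  path_between G (verts (B u)) (verts (B v)) (P e) (Q e)) \<and>
           (\<forall>w\<in>verts H. inner_verts (P e) \<inter> verts (B w) = {} \<and>
                        set (Q e) \<inter> edges (B w) = {})) \<and>
        (\<forall>e\<in>edges H. \<forall>f\<in>edges H. e \<noteq> f \<longrightarrow>
           inner_verts (P e) \<inter> inner_verts (P f) = {} \<and> set (Q e) \<inter> set (Q f) = {}))"

end

theory Submission
  imports Defs
begin

text \<open>
  All three properties are compared with edge cuts between two disjoint connected vertex sets.
  If \<open>X\<close>, \<open>Y\<close> violate the bottleneck condition, let \<open>A\<close> be the component of \<open>G - Y\<close>
  containing \<open>X\<close>; its complement \<open>B\<close> is connected, and more than \<open>n\<close> edges cross from \<open>A\<close>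
  to \<open>B\<close>. These edges form a dipole minor, so Menger's theorem is not needed. Four crossing
  edges can be paired up so that both pairs are completed to cycles which meet in \<open>A\<close> and
  in \<open>B\<close> but share no crossing edge.
\<close>

section \<open>Paths\<close>

text \<open>The comparison with dipole minors works for every \<open>n\<close>: pairwise
  edge-disjoint paths between two sets force a hitting set to be at least as large as their number,
  and each crossing edge of a cut is by itself a path between the two sides. The number four comes
  from the cycles: a cycle meeting both sides of a cut crosses it at least twice, so two cycles
  without a common crossing edge call for four such edges. The obstacle is that nothing is known
  about where these edges end. Ends may coincide, and the paths chosen to join them inside one side
  may be disjoint, so that the two cycles share nothing there. The only freedom is the choice of the
  pairing, and the same pairing has to succeed on both sides at once.\<close>

lemma is_path_Nil [simp]: "\<not> is_path G [] es"
  by (simp add: is_path_def)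

lemma is_path_singleton [simp]: "is_path G [u] es \<longleftrightarrow> es = [] \<and> u \<in> verts G"
  by (auto simp: is_path_def)

lemma is_path_no_edges: "is_path G vs [] \<longleftrightarrow> (\<exists>u \<in> verts G. vs = [u])"
  by (auto simp: is_path_def length_Suc_conv)

lemma is_path_Cons_Cons [simp]:
  "is_path G (u # w # vs) (e # es) \<longleftrightarrow>
     u \<in> verts G \<and> u \<notin> set (w # vs) \<and> e \<in> edges G \<and> ends G e = Upair u w \<and> is_path G (w # vs) es"
  by (auto simp: is_path_def All_less_Suc2)

text \<open>Both pieces contain \<open>v\<close>, so their own distinctness already keeps
  \<open>v\<close> off \<open>xs\<close> and \<open>ys\<close>; only the disjointness of
  \<open>xs\<close> and \<open>ys\<close> remains to be demanded.\<close>

lemma is_path_join: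
  assumes "length es = length xs"
  shows "is_path G (xs @ v # ys) (es @ fs) \<longleftrightarrow>
     is_path G (xs @ [v]) es \<and> is_path G (v # ys) fs \<and> set xs \<inter> set ys = {}"
  using assms
proof (induction es xs rule: list_induct2)
  case Nil
  then show ?case by (auto simp: is_path_def)
next
  case (Cons e es x xs)
  then show ?case by (cases xs) auto
qed

lemma is_path_split:
  assumes "is_path G (xs @ v # ys) es"
  obtains es1 es2 where "es = es1 @ es2" "is_path G (xs @ [v]) es1" "is_path G (v # ys) es2"
proof -
  have l: "length es = length xs + length ys"
    using assms by (simp add: is_path_def)
  have "is_path G (xs @ v # ys) (take (length xs) es @ drop (length xs) es)"
    using assms by simp
  then have "is_path G (xs @ [v]) (take (length xs) es)" "is_path G (v # ys) (drop (length xs) es)"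
    using is_path_join[of "take (length xs) es" xs G v ys "drop (length xs) es"] l by auto
  then show thesis
    using that[of "take (length xs) es" "drop (length xs) es"] by simp
qed

text \<open>The pieces are linked by an edge \<open>e\<close> instead of a shared vertex. The length
  assumption fixes the position of \<open>e\<close>; the rest is a join at
  \<open>last vs\<close>.\<close>

lemma is_path_append:
  assumes "length vs = Suc (length es)"
  shows "is_path G (vs @ ws) (es @ e # fs) \<longleftrightarrow>
     is_path G vs es \<and> is_path G ws fs \<and> set vs \<inter> set ws = {} \<and>
     e \<in> edges G \<and> ends G e = Upair (last vs) (hd ws)"
proof -
  have ne: "vs \<noteq> []" using assms by auto
  have "length es = length (butlast vs)" using assms by simp
  from is_path_join[OF this, of G "last vs" ws "e # fs"] ne
  have *: "is_path G (vs @ ws) (es @ e # fs) \<longleftrightarrow>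
     is_path G vs es \<and> is_path G (last vs # ws) (e # fs) \<and> set (butlast vs) \<inter> set ws = {}"
    by simp (metis append_butlast_last_id append_Cons append_Nil append_assoc)
  have s: "set vs = insert (last vs) (set (butlast vs))"
    using ne by (metis append_butlast_last_id list.simps(15) rotate1.simps(2) set_rotate1)
  have "is_path G vs es \<Longrightarrow> last vs \<in> verts G"
    using ne by (auto simp: is_path_def)
  with * s show ?thesis by (cases ws) auto
qed

lemma is_path_rev:
  assumes "is_path G vs es"
  shows "is_path G (rev vs) (rev es)"
  using assms
proof (induction es arbitrary: vs)
  case Nil
  then show ?case by (auto simp: is_path_no_edges)
next
  case (Cons e es)
  then obtain u w ws where vs: "vs = u # w # ws"
    by (auto simp: is_path_def length_Suc_conv)
  have p: "is_path G (rev (w # ws)) (rev es)" "u \<in> verts G" "u \<notin> set (w # ws)"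
    "e \<in> edges G" "ends G e = Upair w u"
    using Cons.prems Cons.IH[of "w # ws"] vs by auto
  then have "is_path G (rev (w # ws) @ [u]) (rev es @ e # [])"
    by (subst is_path_append) (auto simp: is_path_def)
  then show ?case by (simp add: vs)
qed

lemma path_between_rev:
  "path_between G X Y vs es \<Longrightarrow> path_between G Y X (rev vs) (rev es)"
  by (cases "vs = []") (auto simp: path_between_def is_path_rev hd_rev last_rev)

lemma is_path_mono:
  assumes "is_path H vs es" "verts H \<subseteq> verts G" "edges H \<subseteq> edges G" "ends H = ends G"
  shows "is_path G vs es"
  using assms by (auto simp: is_path_def)

text \<open>The first step leaving \<open>A\<close> provides the edge. That \<open>b\<close> lies on
  the path is recorded because it places \<open>b\<close> in the graph, hence in the complement of
  \<open>A\<close>.\<close>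

lemma path_crosses:
  assumes "is_path G vs es" "hd vs \<in> A" "last vs \<notin> A"
  obtains e a b where "e \<in> set es" "ends G e = Upair a b" "a \<in> A" "b \<notin> A" "b \<in> set vs"
proof -
  have "\<exists>e \<in> set es. \<exists>a \<in> A. \<exists>b. b \<notin> A \<and> b \<in> set vs \<and> ends G e = Upair a b"
    using assms
  proof (induction es arbitrary: vs)
    case Nil
    then show ?case by (auto simp: is_path_no_edges)
  next
    case (Cons e es)
    then obtain u w ws where vs: "vs = u # w # ws"
      by (auto simp: is_path_def length_Suc_conv)
    show ?case
    proof (cases "w \<in> A")
      case True
      have "is_path G (w # ws) es" "last (w # ws) \<notin> A" using Cons.prems vs by auto
      then have "\<exists>e \<in> set es. \<exists>a \<in> A. \<exists>b. b \<notin> A \<and> b \<in> set (w # ws) \<and> ends G e = Upair a b"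
        using Cons.IH[of "w # ws"] True by simp
      then show ?thesis unfolding vs by (meson list.set_intros(2))
    next
      case False
      then show ?thesis using Cons.prems vs by auto
    qed
  qed
  then show thesis using that by blast
qed

lemma path_edge_ends:
  assumes "is_path G vs es" "e \<in> set es"
  shows "set_uprod (ends G e) \<subseteq> set vs"
proof -
  obtain i where i: "i < length es" "e = es ! i" using assms(2) by (metis in_set_conv_nth)
  then show ?thesis using assms(1) by (auto simp: is_path_def)
qed

text \<open>Every vertex starts an edge of the path except the last, which ends the last edge. This
  lets containment of edges in a cycle be turned into containment of vertices; the one-vertex path
  is the exception.\<close>

lemma path_vertex_end:
  assumes "is_path G vs es" "es \<noteq> []" "x \<in> set vs"
  shows "\<exists>e \<in> set es. x \<in> set_uprod (ends G e)"
proof -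
  obtain i where i: "i < length vs" "x = vs ! i" using assms(3) by (metis in_set_conv_nth)
  have l: "length vs = Suc (length es)" using assms(1) by (simp add: is_path_def)
  have E: "ends G (es ! j) = Upair (vs ! j) (vs ! Suc j)" if "j < length es" for j
    using assms(1) that by (simp add: is_path_def)
  show ?thesis
  proof (cases "i < length es")
    case True
    then show ?thesis using E[of i] i by (intro bexI[of _ "es ! i"]) auto
  next
    case False
    then have "i = Suc (length es - 1)" "length es - 1 < length es"
      using l i assms(2) by auto
    then show ?thesis using E[of "length es - 1"] i by (intro bexI[of _ "es ! (length es - 1)"]) auto
  qed
qed

text \<open>The first vertex is an end of the first edge but does not occur later, so that edge
  cannot recur.\<close>

lemma path_distinct_edges:
  assumes "is_path G vs es"
  shows "distinct es"
  using assms
proof (induction es arbitrary: vs)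
  case (Cons e es)
  then obtain u w ws where vs: "vs = u # w # ws"
    by (auto simp: is_path_def length_Suc_conv)
  have p: "is_path G (w # ws) es" "u \<notin> set (w # ws)" "ends G e = Upair u w"
    using Cons.prems vs by auto
  have "e \<notin> set es" using path_edge_ends[OF p(1), of e] p(2,3) by auto
  then show ?case using Cons.IH[OF p(1)] by simp
qed simp

lemma is_path_split_edge:
  assumes "is_path G vs (es @ e # fs)"
  obtains ps qs where "vs = ps @ qs" "is_path G ps es" "is_path G qs fs"
    "set ps \<inter> set qs = {}" "ends G e = Upair (last ps) (hd qs)"
proof -
  let ?k = "Suc (length es)"
  have l: "length (take ?k vs) = ?k" using assms by (simp add: is_path_def)
  have "is_path G (take ?k vs @ drop ?k vs) (es @ e # fs)" using assms by simp
  then show thesis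
    using that[of "take ?k vs" "drop ?k vs"] is_path_append[OF l] append_take_drop_id[of ?k vs]
    by metis
qed

section \<open>Connectedness\<close>

text \<open>Reachability under \<open>(adj G)\<^sup>*\<close> stands in for paths in questions of
  connectedness: walks can be concatenated freely, whereas paths would have to be kept
  distinct.\<close>

definition adj :: "('v, 'e) mgraph \<Rightarrow> ('v \<times> 'v) set" where
  "adj G = {(x, y). x \<in> verts G \<and> y \<in> verts G \<and> (\<exists>e\<in>edges G. ends G e = Upair x y)}"

lemma adj_sym: "(x, y) \<in> adj G \<Longrightarrow> (y, x) \<in> adj G"
  by (force simp: adj_def)

lemma sym_adj: "sym (adj G)"
  by (auto intro: symI adj_sym)

lemma adj_rtrancl_sym: "(x, y) \<in> (adj G)\<^sup>* \<Longrightarrow> (y, x) \<in> (adj G)\<^sup>*"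
  by (meson sym_adj sym_rtrancl symD)

text \<open>An edge can be chosen separately for each pair of consecutive vertices, so paths can be
  cut and recombined as plain vertex lists.\<close>

lemma ex_path_iff:
  "(\<exists>es. is_path G vs es) \<longleftrightarrow>
     vs \<noteq> [] \<and> distinct vs \<and> set vs \<subseteq> verts G \<and> successively (\<lambda>x y. (x, y) \<in> adj G) vs"
proof (induction vs rule: induct_list012)
  case (3 u w vs)
  have "(\<exists>es. is_path G (u # w # vs) es) \<longleftrightarrow> (\<exists>e es. is_path G (u # w # vs) (e # es))"
    by (metis is_path_no_edges list.inject neq_Nil_conv)
  also have "\<dots> \<longleftrightarrow> u \<in> verts G \<and> u \<notin> set (w # vs) \<and> (\<exists>e \<in> edges G. ends G e = Upair u w) \<and>
       (\<exists>es. is_path G (w # vs) es)"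
    by auto
  finally show ?case using "3.IH"(2) by (auto simp: adj_def)
qed auto

lemma path_rtrancl:
  assumes "is_path G vs es" "x \<in> set vs"
  shows "(hd vs, x) \<in> (adj G)\<^sup>*"
  using assms
proof (induction es arbitrary: vs)
  case Nil
  then show ?case by (auto simp: is_path_no_edges)
next
  case (Cons e es)
  then obtain u w ws where vs: "vs = u # w # ws"
    by (auto simp: is_path_def length_Suc_conv)
  have "(u, w) \<in> adj G"
    using ex_path_iff[of G vs] Cons.prems(1) vs by (metis successively.simps(3))
  then show ?case using Cons.IH[of "w # ws"] Cons.prems vs
    by (auto intro: converse_rtrancl_into_rtrancl)
qed

text \<open>A walk is shortened as it grows: if the next vertex already lies on the path built so
  far, the path is cut off there.\<close>

lemma rtrancl_path:
  assumes "(u, v) \<in> (adj G)\<^sup>*" "u \<in> verts G"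
  shows "\<exists>vs es. path_between G {u} {v} vs es"
  using assms(1)
proof (induction rule: rtrancl_induct)
  case base
  then show ?case using assms(2) by (intro exI[of _ "[u]"] exI[of _ "[]"]) (simp add: path_between_def)
next
  case (step y z)
  then obtain vs es where p: "is_path G vs es" "hd vs = u" "last vs = y"
    by (auto simp: path_between_def)
  show ?case
  proof (cases "z \<in> set vs")
    case True
    then obtain xs ys where vs: "vs = xs @ z # ys" by (meson split_list)
    with p obtain es1 where "is_path G (xs @ [z]) es1" by (metis is_path_split)
    moreover have "hd (xs @ [z]) = u" using p vs by (cases xs) auto
    ultimately show ?thesis by (auto simp: path_between_def)
  next
    case False
    obtain e where e: "e \<in> edges G" "ends G e = Upair y z" "z \<in> verts G"
      using step by (auto simp: adj_def)
    have "is_path G (vs @ [z]) (es @ [e])"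
      using p e False by (subst is_path_append) (auto simp: is_path_def)
    moreover have "hd (vs @ [z]) = u" using p by (cases vs) auto
    ultimately show ?thesis by (metis path_between_def last_snoc singletonI)
  qed
qed

lemma connected_graph_iff:
  "connected_graph G \<longleftrightarrow>
     verts G \<noteq> {} \<and> (\<forall>u\<in>verts G. \<forall>v\<in>verts G. (u, v) \<in> (adj G)\<^sup>*)"
proof -
  have "(\<exists>vs es. path_between G {u} {v} vs es) \<longleftrightarrow> (u, v) \<in> (adj G)\<^sup>*" if "u \<in> verts G" for u v
  proof
    assume "\<exists>vs es. path_between G {u} {v} vs es"
    then obtain vs es where p: "is_path G vs es" "hd vs = u" "last vs = v"
      by (auto simp: path_between_def)
    moreover have "vs \<noteq> []" using p(1) by auto
    ultimately show "(u, v) \<in> (adj G)\<^sup>*" using path_rtrancl by fastforce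
  qed (use that rtrancl_path[of u v G] in blast)
  then show ?thesis by (simp add: connected_graph_def)
qed

lemma adj_mono:
  "verts H \<subseteq> verts G \<Longrightarrow> edges H \<subseteq> edges G \<Longrightarrow> ends H = ends G \<Longrightarrow> adj H \<subseteq> adj G"
  by (auto simp: adj_def)

lemma adj_induced: "X \<subseteq> verts G \<Longrightarrow> adj (induced G X) = adj G \<inter> X \<times> X"
  by (auto simp: adj_def induced_def)

lemma verts_induced [simp]: "verts (induced G X) = X"
  by (simp add: induced_def)

lemma connected_vertex_set_iff:
  "connected_vertex_set G X \<longleftrightarrow>
     X \<subseteq> verts G \<and> X \<noteq> {} \<and> (\<forall>u\<in>X. \<forall>v\<in>X. (u, v) \<in> (adj G \<inter> X \<times> X)\<^sup>*)"
  by (auto simp: connected_vertex_set_def connected_graph_iff adj_induced)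

lemma connected_vertex_setI:
  assumes "X \<subseteq> verts G" "x \<in> X" "\<And>u. u \<in> X \<Longrightarrow> (u, x) \<in> (adj G \<inter> X \<times> X)\<^sup>*"
  shows "connected_vertex_set G X"
  unfolding connected_vertex_set_iff
proof (intro conjI ballI)
  fix u v assume "u \<in> X" "v \<in> X"
  then show "(u, v) \<in> (adj G \<inter> X \<times> X)\<^sup>*"
    using assms(3)[of u] assms(3)[of v] adj_rtrancl_sym[of v x "induced G X"] assms(1)
    by (auto simp: adj_induced)
qed (use assms in auto)

text \<open>Branch sets of minors are subgraphs, while bottlenecks speak of vertex sets. Passing to
  the induced subgraph only adds edges, which preserves connectedness.\<close>

lemma connected_vertex_set_subgraph:
  assumes "subgraph H G" "connected_graph H"
  shows "connected_vertex_set G (verts H)"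
proof -
  have "adj H \<subseteq> adj (induced G (verts H))"
    using assms(1) by (intro adj_mono) (fastforce simp: subgraph_def induced_def multigraph_def)+
  then have "(adj H)\<^sup>* \<subseteq> (adj (induced G (verts H)))\<^sup>*"
    by (rule rtrancl_mono)
  then show ?thesis
    using assms by (auto simp: connected_vertex_set_def connected_graph_iff subgraph_def)
qed

lemma connected_vertex_set_path:
  assumes "is_path G vs es"
  shows "connected_vertex_set G (set vs)"
proof -
  have p: "is_path (induced G (set vs)) vs es"
    using assms path_edge_ends[OF assms] unfolding is_path_def induced_def by auto
  have "vs \<noteq> []" using assms by auto
  then show ?thesis
    using assms path_rtrancl[OF p, THEN adj_rtrancl_sym]
    by (intro connected_vertex_setI[of _ _ "hd vs"]) (auto simp: is_path_def adj_induced)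
qed

lemma connected_vertex_set_Un:
  assumes "connected_vertex_set G X" "connected_vertex_set G Y" "X \<inter> Y \<noteq> {}"
  shows "connected_vertex_set G (X \<union> Y)"
proof -
  obtain z where z: "z \<in> X" "z \<in> Y" using assms(3) by auto
  have m: "(adj G \<inter> X \<times> X)\<^sup>* \<subseteq> (adj G \<inter> (X \<union> Y) \<times> (X \<union> Y))\<^sup>*"
      "(adj G \<inter> Y \<times> Y)\<^sup>* \<subseteq> (adj G \<inter> (X \<union> Y) \<times> (X \<union> Y))\<^sup>*"
    by (auto intro!: rtrancl_mono)
  show ?thesis
  proof (rule connected_vertex_setI)
    show "X \<union> Y \<subseteq> verts G" "z \<in> X \<union> Y"
      using assms z by (auto simp: connected_vertex_set_iff)
    fix u assume "u \<in> X \<union> Y"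
    then have "(u, z) \<in> (adj G \<inter> X \<times> X)\<^sup>* \<or> (u, z) \<in> (adj G \<inter> Y \<times> Y)\<^sup>*"
      using assms z unfolding connected_vertex_set_iff by blast
    then show "(u, z) \<in> (adj G \<inter> (X \<union> Y) \<times> (X \<union> Y))\<^sup>*"
      using m by blast
  qed
qed

section \<open>Bottlenecks and dipole minors\<close>

lemma edge_bottleneckedE:
  assumes "edge_bottlenecked n G" "connected_vertex_set G X" "connected_vertex_set G Y" "X \<inter> Y = {}"
  obtains S where "finite S" "card S \<le> n"
    "\<And>vs es. path_between G X Y vs es \<Longrightarrow> set es \<inter> S \<noteq> {}"
proof -
  have "\<exists>S. S \<subseteq> edges G \<and> finite S \<and> card S \<le> n \<and>
             (\<forall>vs es. path_between G X Y vs es \<longrightarrow> set es \<inter> S \<noteq> {})"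
    using assms unfolding edge_bottlenecked_def by simp
  then show thesis by (elim exE conjE) (rule that; blast)
qed

text \<open>Every path from \<open>X\<close> to \<open>Y\<close> passes from \<open>A\<close> to
  \<open>B\<close>, so the crossing edges form a hitting set and cannot be \<open>n\<close> or
  fewer.\<close>

lemma not_edge_bottlenecked_cut:
  assumes G: "connected_graph G" and n: "\<not> edge_bottlenecked n G"
  obtains A B T where "connected_vertex_set G A" "connected_vertex_set G B" "A \<inter> B = {}"
    "T \<subseteq> edges G" "finite T" "card T = Suc n"
    "\<And>e. e \<in> T \<Longrightarrow> \<exists>a\<in>A. \<exists>b\<in>B. ends G e = Upair a b"
proof -
  obtain X Y where X: "connected_vertex_set G X" and Y: "connected_vertex_set G Y"
    and XY: "X \<inter> Y = {}"
    and XYn: "\<not> (\<exists>S. S \<subseteq> edges G \<and> finite S \<and> card S \<le> n \<and>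
             (\<forall>vs es. path_between G X Y vs es \<longrightarrow> set es \<inter> S \<noteq> {}))"
    using n unfolding edge_bottlenecked_def not_all not_imp by (elim exE conjE) (rule that)
  obtain x where x: "x \<in> X" using X by (auto simp: connected_vertex_set_iff)
  have XV: "X \<subseteq> verts G" and YV: "Y \<subseteq> verts G"
    using X Y by (auto simp: connected_vertex_set_iff)
  let ?W = "verts G - Y"
  define A where "A = {z. (x, z) \<in> (adj G \<inter> ?W \<times> ?W)\<^sup>*}"
  define B where "B = verts G - A"
  have xW: "x \<in> ?W" using x XY XV by auto
  have AW: "A \<subseteq> ?W"
  proof
    fix z assume "z \<in> A"
    then have "(x, z) \<in> (adj G \<inter> ?W \<times> ?W)\<^sup>*" by (simp add: A_def)
    then show "z \<in> ?W" by (cases rule: rtranclE) (use xW in auto)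
  qed
  have XA: "X \<subseteq> A"
  proof
    fix z assume "z \<in> X"
    then have "(x, z) \<in> (adj G \<inter> X \<times> X)\<^sup>*" using X x by (auto simp: connected_vertex_set_iff)
    moreover have "(adj G \<inter> X \<times> X)\<^sup>* \<subseteq> (adj G \<inter> ?W \<times> ?W)\<^sup>*"
      using XY XV by (intro rtrancl_mono) auto
    ultimately show "z \<in> A" by (auto simp: A_def)
  qed
  have A: "connected_vertex_set G A"
  proof (rule connected_vertex_setI)
    show "A \<subseteq> verts G" "x \<in> A" using AW XA x by auto
    fix z assume "z \<in> A"
    then have "(x, z) \<in> (adj G \<inter> ?W \<times> ?W)\<^sup>*" by (simp add: A_def)
    then have "(x, z) \<in> (adj G \<inter> A \<times> A)\<^sup>*"
    proof (induction rule: rtrancl_induct)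
      case (step y z)
      then have "y \<in> A" "z \<in> A" by (auto simp: A_def intro: rtrancl_into_rtrancl)
      then have "(y, z) \<in> adj G \<inter> A \<times> A" using step.hyps(2) by blast
      with step.IH show ?case by (rule rtrancl_into_rtrancl)
    qed simp
    then show "(z, x) \<in> (adj G \<inter> A \<times> A)\<^sup>*"
      using adj_rtrancl_sym[of x z "induced G A"] adj_induced[of A G] AW Diff_subset[of "verts G" Y]
      by (metis subset_trans)
  qed
  have YB: "Y \<subseteq> B" using AW YV by (auto simp: B_def)
  \<comment> \<open>A walk from \<open>B\<close> towards \<open>Y\<close> stays in \<open>B\<close>
    until it meets \<open>Y\<close>: a vertex outside \<open>Y\<close> with a neighbour in
    \<open>A\<close> would itself belong to the component \<open>A\<close>.\<close>
  have to_Y: "\<exists>y'\<in>Y. (z, y') \<in> (adj G \<inter> B \<times> B)\<^sup>*" if "(z, y) \<in> (adj G)\<^sup>*" "y \<in> Y" "z \<in> B" for y z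
    using that(1,3)
  proof (induction rule: converse_rtrancl_induct)
    case base
    then show ?case using that(2) by blast
  next
    case (step z z')
    show ?case
    proof (cases "z \<in> Y")
      case False
      have "z' \<in> B"
      proof (rule ccontr)
        assume "z' \<notin> B"
        then have z': "z' \<in> A" using step.hyps(1) by (auto simp: B_def adj_def)
        have "(z', z) \<in> adj G \<inter> ?W \<times> ?W"
          using z' AW False step adj_sym[of z z' G] by (auto simp: B_def)
        then have "z \<in> A" using z' by (auto simp: A_def intro: rtrancl_into_rtrancl)
        then show False using step.prems by (simp add: B_def)
      qed
      then have zz: "(z, z') \<in> adj G \<inter> B \<times> B" using step by blast
      obtain y' where y': "y' \<in> Y" "(z', y') \<in> (adj G \<inter> B \<times> B)\<^sup>*"
        using step.IH[OF \<open>z' \<in> B\<close>] by blast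
      show ?thesis using converse_rtrancl_into_rtrancl[OF zz y'(2)] y'(1) by (rule bexI)
    qed blast
  qed
  obtain y where y: "y \<in> Y" using Y by (auto simp: connected_vertex_set_iff)
  have B: "connected_vertex_set G B"
  proof (rule connected_vertex_setI)
    show "B \<subseteq> verts G" "y \<in> B" using YB y by (auto simp: B_def)
    fix z assume z: "z \<in> B"
    then have "(z, y) \<in> (adj G)\<^sup>*" using G y YV by (auto simp: connected_graph_iff B_def)
    then obtain y' where y': "y' \<in> Y" "(z, y') \<in> (adj G \<inter> B \<times> B)\<^sup>*" using to_Y y z by blast
    have "(y', y) \<in> (adj G \<inter> Y \<times> Y)\<^sup>*" using Y y y' by (auto simp: connected_vertex_set_iff)
    moreover have "(adj G \<inter> Y \<times> Y)\<^sup>* \<subseteq> (adj G \<inter> B \<times> B)\<^sup>*"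
      using YB by (intro rtrancl_mono) auto
    ultimately show "(z, y) \<in> (adj G \<inter> B \<times> B)\<^sup>*" using y'(2) by auto
  qed
  define E where "E = {e \<in> edges G. \<exists>a\<in>A. \<exists>b\<in>B. ends G e = Upair a b}"
  have hit: "set es \<inter> E \<noteq> {}" if p: "path_between G X Y vs es" for vs es
  proof -
    have "is_path G vs es" "hd vs \<in> A" "last vs \<notin> A"
      using p XA YB by (auto simp: path_between_def B_def)
    then obtain e a b where "e \<in> set es" "ends G e = Upair a b" "a \<in> A" "b \<notin> A" "b \<in> set vs"
      by (rule path_crosses)
    then have "e \<in> E" using \<open>is_path G vs es\<close> by (auto simp: E_def B_def is_path_def)
    then show ?thesis using \<open>e \<in> set es\<close> by auto
  qed
  \<comment> \<open>The cut may be infinite, and then \<open>card E\<close> is 0 and says nothing.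
    In either case exactly \<open>Suc n\<close> of its edges are kept.\<close>
  have "\<exists>T\<subseteq>E. finite T \<and> card T = Suc n"
  proof (cases "finite E")
    case True
    have "E \<subseteq> edges G" by (auto simp: E_def)
    then have "\<not> card E \<le> n" using XYn True hit by meson
    then have "Suc n \<le> card E" by simp
    then obtain T where "T \<subseteq> E" "card T = Suc n" by (rule obtain_subset_with_card_n)
    then show ?thesis using True finite_subset by blast
  next
    case False
    from infinite_arbitrarily_large[OF this] show ?thesis by metis
  qed
  then obtain T where T: "T \<subseteq> E" "finite T" "card T = Suc n" by blast
  show thesis
  proof (rule that[OF A B])
    show "A \<inter> B = {}" by (auto simp: B_def)
    show "T \<subseteq> edges G" "finite T" "card T = Suc n" using T by (auto simp: E_def)
    show "\<exists>a\<in>A. \<exists>b\<in>B. ends G e = Upair a b" if "e \<in> T" for e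
      using that T(1) by (auto simp: E_def)
  qed
qed

lemma not_edge_bottlenecked_imp_dipole_minor:
  assumes "connected_graph G" "\<not> edge_bottlenecked n G"
  shows "has_minor G (dipole (Suc n))"
proof -
  obtain A B T where A: "connected_vertex_set G A" and B: "connected_vertex_set G B"
    and AB: "A \<inter> B = {}" and T: "T \<subseteq> edges G" "finite T" "card T = Suc n"
    and x: "\<And>e. e \<in> T \<Longrightarrow> \<exists>a\<in>A. \<exists>b\<in>B. ends G e = Upair a b"
    using not_edge_bottlenecked_cut[OF assms] by metis
  obtain a b where ab: "\<And>e. e \<in> T \<Longrightarrow> a e \<in> A \<and> b e \<in> B \<and> ends G e = Upair (a e) (b e)"
    using x by metis
  obtain h where h: "bij_betw h {..<Suc n} T"
    using T by (metis ex_bij_betw_nat_finite lessThan_atLeast0)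
  have hT: "h i \<in> T" if "i < Suc n" for i using h that by (auto simp: bij_betw_def)
  have inj: "h i \<noteq> h j" if "i < Suc n" "j < Suc n" "i \<noteq> j" for i j
    using h that by (auto simp: bij_betw_def inj_on_def)
  have AV: "A \<subseteq> verts G" "B \<subseteq> verts G" using A B by (auto simp: connected_vertex_set_def)
  have sub: "subgraph (induced G X) G" if "X \<subseteq> verts G" for X
    using that by (auto simp: subgraph_def induced_def multigraph_def)
  have pb: "path_between G A B [a (h i), b (h i)] [h i]" if "i < Suc n" for i
    using ab[OF hT[OF that]] AB AV T hT[OF that] by (auto simp: path_between_def)
  have ne: "h i \<notin> edges (induced G A)" "h i \<notin> edges (induced G B)" if "i < Suc n" for i
    using ab[OF hT[OF that]] AB by (auto simp: induced_def)
  show ?thesis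
    unfolding has_minor_def
  \<comment> \<open>The dipole vertex \<open>False\<close> receives the side \<open>A\<close> and
    \<open>True\<close> the side \<open>B\<close>. The path of an edge is a single crossing edge,
    which has no inner vertices and lies in neither induced subgraph.\<close>
  proof (rule exI[of _ "\<lambda>w. if w then induced G B else induced G A"],
      rule exI[of _ "\<lambda>i. [a (h i), b (h i)]"], rule exI[of _ "\<lambda>i. [h i]"], intro conjI ballI impI)
    fix i assume i: "i \<in> edges (dipole (Suc n))"
    show "\<exists>u v. ends (dipole (Suc n)) i = Upair u v \<and>
        path_between G (verts (if u then induced G B else induced G A))
          (verts (if v then induced G B else induced G A)) [a (h i), b (h i)] [h i]"
      using pb[of i] i by (intro exI[of _ False] exI[of _ True]) (auto simp: dipole_def)
  qed (use A B AV sub AB ne inj in \<open>auto simp: dipole_def connected_vertex_set_def inner_verts_def\<close>)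
qed

text \<open>The \<open>Suc n\<close> paths of the minor share no edges, so a set hitting all of them
  contains a different element for each.\<close>

lemma dipole_minor_imp_not_edge_bottlenecked:
  assumes "has_minor G (dipole (Suc n))"
  shows "\<not> edge_bottlenecked n G"
proof
  assume bn: "edge_bottlenecked n G"
  obtain B P Q where B: "\<And>w. subgraph (B w) G \<and> connected_graph (B w)"
    and disj: "\<And>w x. w \<noteq> x \<Longrightarrow> verts (B w) \<inter> verts (B x) = {}"
    and P: "\<And>i. i < Suc n \<Longrightarrow> \<exists>u v. Upair False True = Upair u v \<and>
                  path_between G (verts (B u)) (verts (B v)) (P i) (Q i)"
    and Q: "\<And>i j. i < Suc n \<Longrightarrow> j < Suc n \<Longrightarrow> i \<noteq> j \<Longrightarrow> set (Q i) \<inter> set (Q j) = {}"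
    using assms unfolding has_minor_def
    apply (elim exE conjE)
    subgoal premises p for B P Q
      by (rule that[of B P Q]) (use p in \<open>auto simp: dipole_def\<close>)
    done
  obtain S where S: "finite S" "card S \<le> n"
    and hit: "\<And>vs es. path_between G (verts (B False)) (verts (B True)) vs es \<Longrightarrow> set es \<inter> S \<noteq> {}"
    using edge_bottleneckedE[OF bn] B connected_vertex_set_subgraph disj[of False True] by metis
  have "set (Q i) \<inter> S \<noteq> {}" if "i < Suc n" for i
  proof -
    \<comment> \<open>The ends of a dipole edge are unordered, so its path may run in either
      direction between the branch sets.\<close>
    from P[OF that] consider
      "path_between G (verts (B False)) (verts (B True)) (P i) (Q i)"
      | "path_between G (verts (B True)) (verts (B False)) (P i) (Q i)"
      by auto
    then show ?thesis
    proof cases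
      case 2
      then show ?thesis using hit[OF path_between_rev] by fastforce
    qed (rule hit)
  qed
  then have "\<forall>i\<in>{..<Suc n}. \<exists>s. s \<in> set (Q i) \<inter> S" by blast
  then obtain s where s: "\<And>i. i < Suc n \<Longrightarrow> s i \<in> set (Q i) \<inter> S" by (metis bchoice lessThan_iff)
  have "inj_on s {..<Suc n}" using s Q by (fastforce simp: inj_on_def)
  then have "card {..<Suc n} \<le> card S" using s S(1) by (intro card_inj_on_le[of s]) auto
  then show False using S(2) by simp
qed

section \<open>Cycles with disconnected intersection\<close>

text \<open>This is \<open>is_cycle\<close> with the two vertices at which the cycle is split made
  explicit, so that they can be moved along it.\<close>

definition cycle_through :: "('v, 'e) mgraph \<Rightarrow> ('v, 'e) mgraph \<Rightarrow> 'v \<Rightarrow> 'v \<Rightarrow> bool" where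
  "cycle_through G C a b \<longleftrightarrow>
     (\<exists>vs es ws fs. a \<noteq> b \<and>
        path_between G {a} {b} vs es \<and> path_between G {a} {b} ws fs \<and>
        set vs \<inter> set ws = {a, b} \<and> set es \<inter> set fs = {} \<and>
        C = \<lparr>verts = set vs \<union> set ws, edges = set es \<union> set fs, ends = ends G\<rparr>)"

lemma is_cycle_iff: "is_cycle G C \<longleftrightarrow> (\<exists>a b. cycle_through G C a b)"
  by (simp add: is_cycle_def cycle_through_def)

lemma cycle_through_sym:
  assumes "cycle_through G C a b"
  shows "cycle_through G C b a"
proof -
  obtain vs es ws fs where c: "a \<noteq> b" "path_between G {a} {b} vs es" "path_between G {a} {b} ws fs"
    "set vs \<inter> set ws = {a, b}" "set es \<inter> set fs = {}"
    "C = \<lparr>verts = set vs \<union> set ws, edges = set es \<union> set fs, ends = ends G\<rparr>"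
    using assms unfolding cycle_through_def by blast
  show ?thesis
    unfolding cycle_through_def
    by (rule exI[of _ "rev vs"], rule exI[of _ "rev es"], rule exI[of _ "rev ws"],
        rule exI[of _ "rev fs"]) (use c path_between_rev[OF c(2)] path_between_rev[OF c(3)] in auto)
qed

text \<open>The stretch of \<open>vs\<close> from \<open>a\<close> to \<open>u\<close> changes
  sides: it is reversed and put in front of \<open>ws\<close>, while the remainder of
  \<open>vs\<close> becomes the other path. The vertex \<open>b\<close> stays fixed.\<close>

lemma cycle_through_reroot_aux:
  assumes ab: "a \<noteq> b"
    and p: "path_between G {a} {b} vs es" and q: "path_between G {a} {b} ws fs"
    and vw: "set vs \<inter> set ws = {a, b}" and ef: "set es \<inter> set fs = {}"
    and u: "u \<in> set vs" "u \<noteq> b"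
  shows "cycle_through G \<lparr>verts = set vs \<union> set ws, edges = set es \<union> set fs, ends = ends G\<rparr> u b"
proof (cases "u = a")
  case True
  then show ?thesis using assms unfolding cycle_through_def by blast
next
  case False
  obtain xs ys where vs: "vs = xs @ u # ys" using u(1) by (meson split_list)
  have dv: "distinct vs" and dw: "distinct ws"
    using p q by (auto simp: path_between_def is_path_def)
  obtain es1 es2 where es: "es = es1 @ es2"
    and p1: "is_path G (xs @ [u]) es1" and p2: "is_path G (u # ys) es2"
    using p is_path_split[of G xs u ys es] unfolding path_between_def vs by metis
  obtain xs' where xs: "xs = a # xs'"
    using p vs False by (cases xs) (auto simp: path_between_def)
  obtain ws' where ws: "ws = a # ws'"
    using q by (cases ws) (auto simp: path_between_def)
  have b: "last (u # ys) = b" using p vs by (simp add: path_between_def)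
  then have bys: "b \<in> set ys" using u(2) by (cases ys) (auto split: if_splits)
  have lw: "last (a # ws') = b" using q ws by (simp add: path_between_def)
  have bws: "b \<in> set ws'" using lw ab by (cases ws') (auto split: if_splits)
  have len: "length (rev es1) = length (u # rev xs')" using p1 xs by (simp add: is_path_def)
  have rp1: "is_path G ((u # rev xs') @ [a]) (rev es1)"
    using is_path_rev[OF p1] xs by simp
  have "set (u # rev xs') \<inter> set ws' = {}"
    using vw dv bys u(2) False unfolding vs xs ws by auto
  then have "is_path G ((u # rev xs') @ a # ws') (rev es1 @ fs)"
    using rp1 q ws len by (subst is_path_join) (auto simp: path_between_def)
  then have n: "path_between G {u} {b} ((u # rev xs') @ a # ws') (rev es1 @ fs)"
    using lw by (simp add: path_between_def)
  have de: "set es1 \<inter> set es2 = {}"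
    using path_distinct_edges[of G vs es] p es by (auto simp: path_between_def)
  show ?thesis
    unfolding cycle_through_def
  proof (intro exI conjI)
    show "path_between G {u} {b} (u # ys) es2" using p2 b by (simp add: path_between_def)
    show "path_between G {u} {b} ((u # rev xs') @ a # ws') (rev es1 @ fs)" by (rule n)
    show "set (u # ys) \<inter> set ((u # rev xs') @ a # ws') = {u, b}"
      using dv vw bys bws unfolding vs xs ws by auto
    show "set es2 \<inter> set (rev es1 @ fs) = {}" using de ef es by auto
  qed (use u in \<open>auto simp: vs xs ws es\<close>)
qed

lemma cycle_through_reroot:
  assumes "cycle_through G C a b" "u \<in> verts C" "u \<noteq> b"
  shows "cycle_through G C u b"
proof -
  obtain vs es ws fs where *: "a \<noteq> b" "path_between G {a} {b} vs es" "path_between G {a} {b} ws fs"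
    "set vs \<inter> set ws = {a, b}" "set es \<inter> set fs = {}"
    and C: "C = \<lparr>verts = set vs \<union> set ws, edges = set es \<union> set fs, ends = ends G\<rparr>"
    using assms(1) unfolding cycle_through_def by blast
  consider "u \<in> set vs" | "u \<in> set ws" using assms(2) C by auto
  then show ?thesis
  proof cases
    case 1
    then show ?thesis using cycle_through_reroot_aux * assms(3) C by metis
  next
    case 2
    then show ?thesis
      using cycle_through_reroot_aux[of a b G ws fs vs es u] * assms(3) C
      by (simp add: Int_commute Un_commute)
  qed
qed

text \<open>At most two rerootings, with the roles of the two split vertices exchanged in between,
  move both to the prescribed places.\<close>

lemma is_cycle_through:
  assumes "is_cycle G C" "u \<in> verts C" "v \<in> verts C" "u \<noteq> v"
  shows "cycle_through G C u v"
proof -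
  have "\<exists>a. cycle_through G C a u"
    using assms(1,2) unfolding is_cycle_iff
    by (metis cycle_through_reroot cycle_through_sym)
  then show ?thesis
    using assms(3,4) by (metis cycle_through_reroot cycle_through_sym)
qed

lemma is_cycle_edge_ends:
  assumes "is_cycle G C" "e \<in> edges C"
  shows "set_uprod (ends G e) \<subseteq> verts C"
proof -
  obtain vs es ws fs where "is_path G vs es" "is_path G ws fs"
    "C = \<lparr>verts = set vs \<union> set ws, edges = set es \<union> set fs, ends = ends G\<rparr>"
    using assms(1) unfolding is_cycle_def path_between_def by blast
  then show ?thesis using assms(2) path_edge_ends by fastforce
qed

lemma is_cycle_ends: "is_cycle G C \<Longrightarrow> ends C = ends G"
  by (auto simp: is_cycle_def)

text \<open>
  For \<open>u\<close>, \<open>v\<close> in distinct components of the intersection, each of the two \<open>u\<close>-\<open>v\<close> paths of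
  \<open>D\<close> has an edge outside \<open>C\<close>. Removing one such edge from each splits \<open>D\<close> into connected
  parts containing \<open>u\<close> and \<open>v\<close>; these are joined by the two removed edges and the two
  \<open>u\<close>-\<open>v\<close> paths of \<open>C\<close>.
\<close>

lemma disconnected_inter_imp_not_edge_bottlenecked:
  assumes C: "is_cycle G C" and D: "is_cycle G D"
    and ne: "verts (graph_inter C D) \<noteq> {}" and nc: "\<not> connected_graph (graph_inter C D)"
  shows "\<not> edge_bottlenecked 3 G"
proof
  assume bn: "edge_bottlenecked 3 G"
  obtain u v where uv: "u \<in> verts C" "u \<in> verts D" "v \<in> verts C" "v \<in> verts D"
    and np: "\<And>vs es. \<not> path_between (graph_inter C D) {u} {v} vs es"
    using ne nc by (auto simp: connected_graph_def graph_inter_def)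
  have "u \<noteq> v"
    using np[of "[u]" "[]"] uv by (auto simp: path_between_def graph_inter_def)
  obtain c1 ce1 c2 ce2 where c: "path_between G {u} {v} c1 ce1" "path_between G {u} {v} c2 ce2"
    "set ce1 \<inter> set ce2 = {}" "edges C = set ce1 \<union> set ce2"
    using is_cycle_through[OF C uv(1,3) \<open>u \<noteq> v\<close>] unfolding cycle_through_def by auto
  obtain d1 de1 d2 de2 where d: "path_between G {u} {v} d1 de1" "path_between G {u} {v} d2 de2"
    "set d1 \<inter> set d2 = {u, v}" "set de1 \<inter> set de2 = {}"
    "D = \<lparr>verts = set d1 \<union> set d2, edges = set de1 \<union> set de2, ends = ends G\<rparr>"
    using is_cycle_through[OF D uv(2,4) \<open>u \<noteq> v\<close>] unfolding cycle_through_def by auto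
  have split: "\<exists>f ps qs pe qe. f \<in> set de \<and> f \<notin> edges C \<and> ds = ps @ qs \<and> set ps \<inter> set qs = {} \<and>
      is_path G ps pe \<and> is_path G qs qe \<and> u \<in> set ps \<and> v \<in> set qs \<and>
      path_between G (set ps) (set qs) [last ps, hd qs] [f]"
    if p: "path_between G {u} {v} ds de" and sub: "set ds \<subseteq> verts D" "set de \<subseteq> edges D" for ds de
  proof -
    \<comment> \<open>Otherwise the vertices of this path would lie on \<open>C\<close> as well, and
      the whole path would join \<open>u\<close> to \<open>v\<close> inside the
      intersection.\<close>
    have "\<not> set de \<subseteq> edges C"
    proof
      assume deC: "set de \<subseteq> edges C"
      have "de \<noteq> []" using p \<open>u \<noteq> v\<close> by (auto simp: path_between_def is_path_no_edges)
      then have "set ds \<subseteq> verts C"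
        using path_vertex_end[of G ds de] is_cycle_edge_ends[OF C] deC p
        by (fastforce simp: path_between_def)
      then have "path_between (graph_inter C D) {u} {v} ds de"
        using p sub deC is_cycle_ends[OF C]
        by (auto simp: path_between_def is_path_def graph_inter_def)
      then show False using np by blast
    qed
    then obtain f where f: "f \<in> set de" "f \<notin> edges C" by blast
    then obtain pe qe where de: "de = pe @ f # qe" by (meson split_list)
    have pth: "is_path G ds (pe @ f # qe)" using p de by (simp add: path_between_def)
    from is_path_split_edge[OF pth] obtain ps qs where s: "ds = ps @ qs" "is_path G ps pe"
      "is_path G qs qe" "set ps \<inter> set qs = {}" "ends G f = Upair (last ps) (hd qs)"
      by metis
    have n: "ps \<noteq> []" "qs \<noteq> []" using s by auto
    have i: "last ps \<in> set ps" "hd qs \<in> set qs" using n by auto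
    have "u \<in> set ps" "v \<in> set qs" using p s(1) n by (auto simp: path_between_def)
    moreover have "path_between G (set ps) (set qs) [last ps, hd qs] [f]"
      using i s pth by (auto simp: path_between_def is_path_def)
    ultimately show ?thesis using f s by blast
  qed
  obtain f1 p1 q1 pe1 qe1 where s1: "f1 \<in> set de1" "f1 \<notin> edges C" "d1 = p1 @ q1"
    "set p1 \<inter> set q1 = {}" "is_path G p1 pe1" "is_path G q1 qe1" "u \<in> set p1" "v \<in> set q1"
    "path_between G (set p1) (set q1) [last p1, hd q1] [f1]"
    using split[OF d(1)] d(5) by auto
  obtain f2 p2 q2 pe2 qe2 where s2: "f2 \<in> set de2" "f2 \<notin> edges C" "d2 = p2 @ q2"
    "set p2 \<inter> set q2 = {}" "is_path G p2 pe2" "is_path G q2 qe2" "u \<in> set p2" "v \<in> set q2"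
    "path_between G (set p2) (set q2) [last p2, hd q2] [f2]"
    using split[OF d(2)] d(5) by auto
  let ?X = "set p1 \<union> set p2" and ?Y = "set q1 \<union> set q2"
  have "connected_vertex_set G ?X" "connected_vertex_set G ?Y"
    using s1 s2 by (auto intro!: connected_vertex_set_Un connected_vertex_set_path)
  \<comment> \<open>The two paths of \<open>D\<close> meet only in \<open>u\<close> and
    \<open>v\<close>, and these have been separated: \<open>u\<close> lies on both initial parts,
    \<open>v\<close> on both final parts.\<close>
  moreover have "?X \<inter> ?Y = {}"
    using d(3) s1(3,4,7,8) s2(3,4,7,8) by auto
  ultimately obtain S where S: "finite S" "card S \<le> 3"
    and hit: "\<And>vs es. path_between G ?X ?Y vs es \<Longrightarrow> set es \<inter> S \<noteq> {}"
    using edge_bottleneckedE[OF bn, of ?X ?Y] by metis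
  have "f1 \<in> S" "f2 \<in> S"
    using hit[of "[last p1, hd q1]" "[f1]"] hit[of "[last p2, hd q2]" "[f2]"] s1(9) s2(9)
    by (auto simp: path_between_def)
  moreover have "set ce1 \<inter> S \<noteq> {}" "set ce2 \<inter> S \<noteq> {}"
    using hit[of c1 ce1] hit[of c2 ce2] c s1(7,8) by (auto simp: path_between_def)
  then obtain g1 g2 where "g1 \<in> set ce1" "g1 \<in> S" "g2 \<in> set ce2" "g2 \<in> S" by blast
  \<comment> \<open>Each \<open>f\<close> lies outside \<open>C\<close> and each \<open>g\<close>
    inside; within either kind the two edges come from edge-disjoint paths. Hence there are four
    distinct edges in \<open>S\<close>, one too many.\<close>
  ultimately have "{f1, f2, g1, g2} \<subseteq> S" "card {f1, f2, g1, g2} = 4"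
    using c(3,4) d(4) s1(1,2) s2(1,2) by (auto simp: card_insert_if)
  then show False using card_mono[of S "{f1, f2, g1, g2}"] S by simp
qed

section \<open>Pairings of four crossing edges\<close>

text \<open>One pairing of four vertices, \<open>p\<close> with \<open>q\<close> and
  \<open>r\<close> with \<open>s\<close>, realised inside one side of a cut. The shared vertex will
  be common to both cycles. The four vertices need not be distinct, since crossing edges may share
  ends.\<close>

definition meeting_paths :: "('v, 'e) mgraph \<Rightarrow> 'v \<Rightarrow> 'v \<Rightarrow> 'v \<Rightarrow> 'v \<Rightarrow> bool" where
  "meeting_paths G p q r s \<longleftrightarrow>
     (\<exists>vs es ws fs. path_between G {p} {q} vs es \<and> path_between G {r} {s} ws fs \<and>
        set vs \<inter> set ws \<noteq> {})"

lemma meeting_paths_swap: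
  assumes "meeting_paths G p q r s"
  shows "meeting_paths G p q s r"
proof -
  obtain vs es ws fs where "path_between G {p} {q} vs es" "path_between G {r} {s} ws fs"
    "set vs \<inter> set ws \<noteq> {}"
    using assms unfolding meeting_paths_def by blast
  then show ?thesis
    unfolding meeting_paths_def using path_between_rev[of G "{r}" "{s}" ws fs]
    by (metis set_rev)
qed

lemma successively_join:
  "successively R (xs @ x # ys) \<longleftrightarrow> successively R (xs @ [x]) \<and> successively R (x # ys)"
  by (auto simp: successively_append_iff)

text \<open>If the two paths of the first pairing are disjoint, a path linking them serves both pairs
  of the second pairing.\<close>

lemma meeting_paths_disj:
  assumes G: "connected_graph G" and V: "p \<in> verts G" "q \<in> verts G" "r \<in> verts G" "s \<in> verts G"
  shows "meeting_paths G p q r s \<or> meeting_paths G p r q s"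
proof (cases "meeting_paths G p q r s")
  case False
  obtain vs es ws fs where P: "path_between G {p} {q} vs es" and Q: "path_between G {r} {s} ws fs"
    using G V unfolding connected_graph_def by meson
  obtain rs gs where R: "path_between G {p} {r} rs gs"
    using G V unfolding connected_graph_def by meson
  have disj: "set vs \<inter> set ws = {}" using False P Q unfolding meeting_paths_def by blast
  have ne: "vs \<noteq> []" "ws \<noteq> []" "rs \<noteq> []" using P Q R by (auto simp: path_between_def)
  \<comment> \<open>The last vertex \<open>x\<close> of the linking path on \<open>vs\<close> and
    the first vertex \<open>y\<close> after it on \<open>ws\<close> bound a stretch whose interior
    avoids both paths.\<close>
  have "\<exists>x\<in>set rs. x \<in> set vs"
    using P R ne by (metis path_between_def hd_in_set singletonD)
  then obtain r1 x r2 where r: "rs = r1 @ x # r2" "x \<in> set vs" "\<forall>z\<in>set r2. z \<notin> set vs"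
    using split_list_last_prop[of rs "\<lambda>z. z \<in> set vs"] by blast
  have "last rs \<in> set ws" using Q R ne by (auto simp: path_between_def)
  then have "\<exists>y\<in>set r2. y \<in> set ws"
    using r(1,2) disj by (cases "r2 = []") auto
  then obtain m y r3 where m: "r2 = m @ y # r3" "y \<in> set ws" "\<forall>z\<in>set m. z \<notin> set ws"
    using split_list_first_prop[of r2 "\<lambda>z. z \<in> set ws"] by blast
  obtain v1 v2 where v: "vs = v1 @ x # v2" using r(2) by (meson split_list)
  obtain w1 w2 where w: "ws = w1 @ y # w2" using m(2) by (meson split_list)
  let ?p = "\<lambda>vs. vs \<noteq> [] \<and> distinct vs \<and> set vs \<subseteq> verts G \<and> successively (\<lambda>x y. (x, y) \<in> adj G) vs"
  have sy: "(\<lambda>x y. (y, x) \<in> adj G) = (\<lambda>x y. (x, y) \<in> adj G)"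
    by (intro ext) (meson adj_sym)
  have paths: "?p vs" "?p ws" "?p rs"
    using P Q R by (auto simp: path_between_def simp flip: ex_path_iff)
  let ?s = "successively (\<lambda>x y. (x, y) \<in> adj G)"
  have "?s vs" "?s ws" "?s rs" using paths by auto
  then have s: "?s (v1 @ [x])" "?s (x # v2)" "?s (w1 @ [y])" "?s (y # w2)" "?s (x # m @ [y])"
    unfolding v w r(1) m(1)
    using successively_join[of _ v1 x v2] successively_join[of _ w1 y w2]
      successively_join[of _ r1 x "m @ y # r3"] successively_join[of _ "x # m" y r3]
    by auto
  have "?s (rev zs)" if "?s zs" for zs
    using that unfolding successively_rev by (subst sy)
  then have "?s (rev (x # v2))" "?s (rev (w1 @ [y]))"
    using s(2,3) by blast+
  then have rs: "?s (rev v2 @ [x])" "?s (y # rev w1)" by simp_all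
  \<comment> \<open>The two paths and the link form the letter H with crossbar from \<open>x\<close>
    to \<open>y\<close>. Both new paths run along the crossbar, which makes them meet.\<close>
  have "?s (v1 @ x # m @ y # rev w1)" "?s (rev v2 @ x # m @ y # w2)"
    using s(1,4,5) rs successively_join[of _ v1 x "m @ y # rev w1"]
      successively_join[of _ "rev v2" x "m @ y # w2"] successively_join[of _ "x # m" y "rev w1"]
      successively_join[of _ "x # m" y w2]
    by simp_all
  moreover have "distinct (v1 @ x # m @ y # rev w1)" "distinct (rev v2 @ x # m @ y # w2)"
    using paths disj r(3) m(3) unfolding v w r(1) m(1) by auto
  moreover have "set (v1 @ x # m @ y # rev w1) \<subseteq> verts G" "set (rev v2 @ x # m @ y # w2) \<subseteq> verts G"
    using paths unfolding v w r(1) m(1) by auto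
  ultimately have "?p (v1 @ x # m @ y # rev w1)" "?p (rev v2 @ x # m @ y # w2)"
    by auto
  then obtain es' fs' where "is_path G (v1 @ x # m @ y # rev w1) es'"
    "is_path G (rev v2 @ x # m @ y # w2) fs'"
    unfolding ex_path_iff[symmetric] by blast
  moreover have "hd (v1 @ x # m @ y # rev w1) = p" "last (v1 @ x # m @ y # rev w1) = r"
    "hd (rev v2 @ x # m @ y # w2) = q" "last (rev v2 @ x # m @ y # w2) = s"
    using P Q unfolding v w
    by (auto simp: path_between_def hd_append last_rev hd_rev split: if_splits)
  ultimately have "path_between G {p} {r} (v1 @ x # m @ y # rev w1) es'"
    "path_between G {q} {s} (rev v2 @ x # m @ y # w2) fs'"
    by (auto simp: path_between_def)
  then show ?thesis unfolding meeting_paths_def by fastforce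
qed simp

text \<open>The edge \<open>e\<close> alone is one of the two paths of the cycle; the other goes
  through \<open>A\<close>, over \<open>e'\<close> and back through \<open>B\<close>. If both inner
  paths are single vertices, the result is a pair of parallel edges, which is why
  \<open>e \<noteq> e'\<close> is assumed explicitly.\<close>

lemma crossing_cycle:
  assumes V: "A \<subseteq> verts G" "B \<subseteq> verts G" "A \<inter> B = {}"
    and p: "path_between (induced G A) {a} {a'} vs es"
    and q: "path_between (induced G B) {b} {b'} ws fs"
    and e: "e \<in> edges G" "ends G e = Upair a b"
    and e': "e' \<in> edges G" "ends G e' = Upair a' b'" "e \<noteq> e'"
  shows "is_cycle G \<lparr>verts = set vs \<union> set ws, edges = {e, e'} \<union> set es \<union> set fs, ends = ends G\<rparr>"
proof -
  have pA: "set vs \<subseteq> A" "set es \<subseteq> edges (induced G A)"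
    and qB: "set ws \<subseteq> B" "set fs \<subseteq> edges (induced G B)"
    using p q by (auto simp: path_between_def is_path_def)
  have ne: "vs \<noteq> []" "ws \<noteq> []" using p q by (auto simp: path_between_def)
  have hl: "hd vs = a" "last vs = a'" "hd ws = b" "last ws = b'"
    using p q by (auto simp: path_between_def)
  have ab: "a \<in> set vs" "b \<in> set ws" using hl ne by auto
  have p': "is_path G vs es" and q': "is_path G ws fs"
    using p q V by (auto simp: path_between_def induced_def elim!: is_path_mono)
  have "is_path G (vs @ rev ws) (es @ e' # rev fs)"
    using p' is_path_rev[OF q'] V(3) pA qB hl e' ne
    by (subst is_path_append) (auto simp: is_path_def hd_rev)
  then have "path_between G {a} {b} (vs @ rev ws) (es @ e' # rev fs)"
    using hl ne by (auto simp: path_between_def last_rev)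
  moreover have "path_between G {a} {b} [a, b] [e]"
    using ab pA qB V e by (auto simp: path_between_def)
  moreover have "a \<notin> B" "b \<notin> A" using ab pA(1) qB(1) V(3) by auto
  then have "e \<notin> edges (induced G A)" "e \<notin> edges (induced G B)"
    using e(2) by (auto simp: induced_def)
  then have "set [e] \<inter> set (es @ e' # rev fs) = {}"
    using pA(2) qB(2) e'(3) by auto
  moreover have "a \<noteq> b" using ab pA qB V by auto
  moreover have "set [a, b] \<inter> set (vs @ rev ws) = {a, b}" using ab by auto
  moreover have "\<lparr>verts = set vs \<union> set ws, edges = {e, e'} \<union> set es \<union> set fs, ends = ends G\<rparr> =
      \<lparr>verts = set [a, b] \<union> set (vs @ rev ws), edges = set [e] \<union> set (es @ e' # rev fs), ends = ends G\<rparr>"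
    using ab by auto
  ultimately show ?thesis
    unfolding is_cycle_def by (intro exI conjI)
qed

text \<open>The meeting points give a common vertex on each side, but the cycles cross the cut in
  different edges, so no common edge connects the two sides.\<close>

lemma crossing_cycles_disconnected:
  assumes V: "A \<subseteq> verts G" "B \<subseteq> verts G" "A \<inter> B = {}"
    and mA: "meeting_paths (induced G A) a1 a2 a3 a4"
    and mB: "meeting_paths (induced G B) b1 b2 b3 b4"
    and E: "e1 \<in> edges G" "e2 \<in> edges G" "e3 \<in> edges G" "e4 \<in> edges G"
    and ends: "ends G e1 = Upair a1 b1" "ends G e2 = Upair a2 b2"
      "ends G e3 = Upair a3 b3" "ends G e4 = Upair a4 b4"
    and dist: "distinct [e1, e2, e3, e4]"
  shows "\<exists>C D. is_cycle G C \<and> is_cycle G D \<and> C \<noteq> D \<and>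
    verts (graph_inter C D) \<noteq> {} \<and> \<not> connected_graph (graph_inter C D)"
proof -
  obtain vs es ws fs where A: "path_between (induced G A) {a1} {a2} vs es"
    "path_between (induced G A) {a3} {a4} ws fs" "set vs \<inter> set ws \<noteq> {}"
    using mA unfolding meeting_paths_def by blast
  obtain vs' es' ws' fs' where B: "path_between (induced G B) {b1} {b2} vs' es'"
    "path_between (induced G B) {b3} {b4} ws' fs'" "set vs' \<inter> set ws' \<noteq> {}"
    using mB unfolding meeting_paths_def by blast
  define C where "C = \<lparr>verts = set vs \<union> set vs', edges = {e1, e2} \<union> set es \<union> set es', ends = ends G\<rparr>"
  define D where "D = \<lparr>verts = set ws \<union> set ws', edges = {e3, e4} \<union> set fs \<union> set fs', ends = ends G\<rparr>"
  have C: "is_cycle G C" unfolding C_def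
    by (rule crossing_cycle[OF V A(1) B(1)]) (use E ends dist in auto)
  have D: "is_cycle G D" unfolding D_def
    by (rule crossing_cycle[OF V A(2) B(2)]) (use E ends dist in auto)
  have sA: "set vs \<subseteq> A" "set es \<subseteq> edges (induced G A)" "set ws \<subseteq> A" "set fs \<subseteq> edges (induced G A)"
    using A by (auto simp: path_between_def is_path_def)
  have sB: "set vs' \<subseteq> B" "set es' \<subseteq> edges (induced G B)" "set ws' \<subseteq> B" "set fs' \<subseteq> edges (induced G B)"
    using B by (auto simp: path_between_def is_path_def)
  obtain x y where x: "x \<in> set vs" "x \<in> set ws" and y: "y \<in> set vs'" "y \<in> set ws'"
    using A(3) B(3) by blast
  have xy: "x \<in> verts (graph_inter C D)" "y \<in> verts (graph_inter C D)"
    using x y by (auto simp: C_def D_def graph_inter_def)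
  have hv: "a1 \<in> A" "a2 \<in> A" "a3 \<in> A" "a4 \<in> A" "b1 \<in> B" "b2 \<in> B" "b3 \<in> B" "b4 \<in> B"
    using A B by (auto simp: path_between_def is_path_def intro: hd_in_set last_in_set)
      (metis hd_in_set last_in_set length_greater_0_conv subsetD zero_less_Suc)+
  have cross: "e1 \<notin> edges (induced G X)" "e2 \<notin> edges (induced G X)"
    "e3 \<notin> edges (induced G X)" "e4 \<notin> edges (induced G X)" if "X = A \<or> X = B" for X
    using that hv ends V(3) by (auto simp: induced_def)
  have inside: "e \<in> edges (induced G A) \<or> e \<in> edges (induced G B)"
    if "e \<in> edges (graph_inter C D)" for e
    using that sA sB dist by (auto simp: C_def D_def graph_inter_def)
  have "\<not> path_between (graph_inter C D) {x} {y} ps qs" for ps qs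
  proof
    assume p: "path_between (graph_inter C D) {x} {y} ps qs"
    then have "is_path (graph_inter C D) ps qs" "hd ps \<in> A" "last ps \<notin> A"
      using x y sA sB V(3) by (auto simp: path_between_def)
    then obtain e a b where e: "e \<in> set qs" "ends (graph_inter C D) e = Upair a b" "a \<in> A" "b \<notin> A"
      by (rule path_crosses)
    have "e \<in> edges (graph_inter C D)" using p e(1) by (auto simp: path_between_def is_path_def)
    then show False
      using inside[of e] e V(3) by (auto simp: induced_def graph_inter_def C_def)
  qed
  then have "\<not> connected_graph (graph_inter C D)"
    using xy unfolding connected_graph_def by blast
  moreover have "C \<noteq> D"
  proof
    assume "C = D"
    then have "e1 \<in> edges D" by (auto simp: C_def)
    then show False using dist sA sB cross(1)[of A] cross(1)[of B] by (auto simp: D_def)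
  qed
  ultimately show ?thesis using C D xy by blast
qed

lemma card_4_distinct:
  assumes "card T = 4"
  obtains a b c d where "T = {a, b, c, d}" "distinct [a, b, c, d]"
proof -
  have "finite T" using assms by (metis card.infinite zero_neq_numeral)
  then obtain xs where xs: "set xs = T" "distinct xs" using finite_distinct_list by blast
  then have "length xs = 4" using assms distinct_card by metis
  then obtain a b c d where "xs = [a, b, c, d]"
    by (auto simp: numeral_eq_Suc length_Suc_conv)
  then show thesis using that xs by auto
qed

text \<open>On either side of the cut at most one of the three pairings of the four crossing edges
  fails to be realised by meeting paths, so some pairing works on both sides.\<close>

lemma not_edge_bottlenecked_imp_disconnected_inter:
  assumes "connected_graph G" "\<not> edge_bottlenecked 3 G"
  shows "\<exists>C D. is_cycle G C \<and> is_cycle G D \<and> C \<noteq> D \<and>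
    verts (graph_inter C D) \<noteq> {} \<and> \<not> connected_graph (graph_inter C D)"
proof -
  obtain A B T where A: "connected_vertex_set G A" and B: "connected_vertex_set G B"
    and AB: "A \<inter> B = {}" and T: "T \<subseteq> edges G" "card T = Suc 3"
    and x: "\<And>e. e \<in> T \<Longrightarrow> \<exists>a\<in>A. \<exists>b\<in>B. ends G e = Upair a b"
    using not_edge_bottlenecked_cut[OF assms] by metis
  have "card T = 4" using T(2) by simp
  then obtain e1 e2 e3 e4 where e: "T = {e1, e2, e3, e4}" "distinct [e1, e2, e3, e4]"
    by (rule card_4_distinct)
  obtain a b where ab: "\<And>e. e \<in> T \<Longrightarrow> a e \<in> A \<and> b e \<in> B \<and> ends G e = Upair (a e) (b e)"
    using x by metis
  have V: "A \<subseteq> verts G" "B \<subseteq> verts G" using A B by (auto simp: connected_vertex_set_def)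
  \<comment> \<open>Three instances of \<open>meeting_paths_disj\<close>, one for each two of the
    three pairings; exchanging the ends of the second path brings them to a common form.\<close>
  have two: "(meeting_paths H p q r s \<or> meeting_paths H p r q s) \<and>
      (meeting_paths H p q r s \<or> meeting_paths H p s q r) \<and>
      (meeting_paths H p r q s \<or> meeting_paths H p s q r)"
    if "connected_graph H" "{p, q, r, s} \<subseteq> verts H" for H :: "('a, 'b) mgraph" and p q r s
    using that meeting_paths_disj[of H p q r s] meeting_paths_disj[of H p q s r]
      meeting_paths_disj[of H p r s q] meeting_paths_swap[of H] by auto
  have "\<exists>p q r s. {p, q, r, s} = T \<and> distinct [p, q, r, s] \<and>
      meeting_paths (induced G A) (a p) (a q) (a r) (a s) \<and>
      meeting_paths (induced G B) (b p) (b q) (b r) (b s)" (is ?ex)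
  proof -
    have ex: ?ex if "{p, q, r, s} = T" "distinct [p, q, r, s]"
      "meeting_paths (induced G A) (a p) (a q) (a r) (a s)"
      "meeting_paths (induced G B) (b p) (b q) (b r) (b s)" for p q r s
      using that by (intro exI conjI)
    have c: "connected_graph (induced G A)" "connected_graph (induced G B)"
      using A B by (auto simp: connected_vertex_set_def)
    have i: "{a e1, a e2, a e3, a e4} \<subseteq> verts (induced G A)"
      "{b e1, b e2, b e3, b e4} \<subseteq> verts (induced G B)"
      using ab e(1) by auto
    consider
      "meeting_paths (induced G A) (a e1) (a e2) (a e3) (a e4)"
      "meeting_paths (induced G B) (b e1) (b e2) (b e3) (b e4)"
      | "meeting_paths (induced G A) (a e1) (a e3) (a e2) (a e4)"
      "meeting_paths (induced G B) (b e1) (b e3) (b e2) (b e4)"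
      | "meeting_paths (induced G A) (a e1) (a e4) (a e2) (a e3)"
      "meeting_paths (induced G B) (b e1) (b e4) (b e2) (b e3)"
      using two[OF c(1) i(1)] two[OF c(2) i(2)] by argo
    then show ?thesis
    proof cases
      case 1
      from ex[OF _ _ this] show ?thesis using e by simp
    next
      case 2
      from ex[OF _ _ this] show ?thesis using e by auto
    next
      case 3
      from ex[OF _ _ this] show ?thesis using e by auto
    qed
  qed
  then obtain p q r s where pq: "{p, q, r, s} = T" "distinct [p, q, r, s]"
      "meeting_paths (induced G A) (a p) (a q) (a r) (a s)"
      "meeting_paths (induced G B) (b p) (b q) (b r) (b s)" by blast
  then have "p \<in> T" "q \<in> T" "r \<in> T" "s \<in> T" by auto
  then show ?thesis
    using ab T(1) by (intro crossing_cycles_disconnected[OF V AB pq(3,4) _ _ _ _ _ _ _ _ pq(2)]) auto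
qed

theorem proposition3p4:
  fixes G :: "('v, 'e) mgraph"
  assumes "multigraph G"
    and "connected_graph G"
    and "infinite (verts G)"
    and "unbounded_graph G"
  shows "(edge_bottlenecked 3 G \<longleftrightarrow>
            (\<forall>C D. is_cycle G C \<and> is_cycle G D \<and> C \<noteq> D \<longrightarrow>
               verts (graph_inter C D) = {} \<or> connected_graph (graph_inter C D)))
       \<and> ((\<forall>C D. is_cycle G C \<and> is_cycle G D \<and> C \<noteq> D \<longrightarrow>
               verts (graph_inter C D) = {} \<or> connected_graph (graph_inter C D)) \<longleftrightarrow>
            \<not> has_minor G (dipole 4))"
proof -
  \<comment> \<open>The general relation between the bound \<open>n\<close> and the dipole with
    \<open>Suc n\<close> edges is taken at \<open>n = 3\<close>, which yields the dipole with four
    edges.\<close>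
  have "edge_bottlenecked 3 G \<longleftrightarrow> \<not> has_minor G (dipole (Suc 3))"
    using not_edge_bottlenecked_imp_dipole_minor dipole_minor_imp_not_edge_bottlenecked assms(2)
    by blast
  moreover have "edge_bottlenecked 3 G \<longleftrightarrow>
      (\<forall>C D. is_cycle G C \<and> is_cycle G D \<and> C \<noteq> D \<longrightarrow>
         verts (graph_inter C D) = {} \<or> connected_graph (graph_inter C D))"
    using not_edge_bottlenecked_imp_disconnected_inter[OF assms(2)]
      disconnected_inter_imp_not_edge_bottlenecked[of G] by blast
  ultimately show ?thesis by simp
qed

end
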